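(* Fix $p\in(0,1]$. Let $(P_n)_{n\geq 1}$ be a sequence of finite posets. Suppose there exist constants $\Gamma\ge 1$ and $\mu>0$ such that $\lvert\mathrm{MC}(P_n)\rvert\leq\Gamma^{(1+o(1))n}$ and the maximum size of a chain in $P_n$ is at most $\mu n$. Then, as $n\to\infty$, \[\mathcal E(J(P_n))\leq\frac{1}{p}\left(\mu+\log\Gamma+\sqrt{2\mu\log\Gamma+(\log\Gamma)^2}\right)n+o(n).\]
   Context: $\mathrm{MC}(P)$ is the set of maximal chains of a poset $P$. $J(P)$ is the distributive lattice of order ideals (down-closed subsets) of $P$ ordered by inclusion. For a finite lattice $L$ and $x\in L$, let $\mathrm{cov}_L(x)$ be the set of elements covered by $x$. The Ungarian Markov chain ${\bf U}_L$ (with fixed probability $p$) has state space $L$: from state $x$, form a random subset $T\subseteq\mathrm{cov}_L(x)$ by including each element independently with probability $p$, and move to $\bigwedge(\{x\}\cup T)$. $\mathcal E(L)$ is the expected number of steps to reach the bottom element $\hat 0$ starting from the top element $\hat 1$. $\log$ is the natural logarithm. *)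

theory Defs
  imports "HOL-Algebra.Lattice" "HOL-Probability.Probability" "HOL-Library.Landau_Symbols"
begin

section \<open>Chains and order ideals of a poset\<close>

definition max_chains :: "('a, 'b) gorder_scheme \<Rightarrow> 'a set set" where
  "max_chains P = {C. pred_on.maxchain (carrier P) (le P) C}"

definition max_chain_size :: "('a, 'b) gorder_scheme \<Rightarrow> nat" where
  "max_chain_size P = Max (card ` {C. pred_on.chain (carrier P) (le P) C})"

definition order_ideals :: "('a, 'b) gorder_scheme \<Rightarrow> 'a set set" where
  "order_ideals P =
     {I. I \<subseteq> carrier P \<and> (\<forall>x\<in>I. \<forall>y\<in>carrier P. y \<sqsubseteq>\<^bsub>P\<^esub> x \<longrightarrow> y \<in> I)}"

definition ideal_lattice :: "('a, 'b) gorder_scheme \<Rightarrow> 'a set gorder" where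
  "ideal_lattice P = \<lparr>carrier = order_ideals P, eq = (=), le = (\<subseteq>)\<rparr>"

lemma lattice_ideal_lattice: "lattice (ideal_lattice P)"
proof -
  interpret partial_order "ideal_lattice P"
    by unfold_locales (auto simp: ideal_lattice_def)
  have "I \<union> I' \<in> order_ideals P" "I \<inter> I' \<in> order_ideals P"
    if "I \<in> order_ideals P" "I' \<in> order_ideals P" for I I'
    using that unfolding order_ideals_def by blast+
  note closed = this
  show ?thesis
  proof unfold_locales
    fix I I'
    assume "I \<in> carrier (ideal_lattice P)" "I' \<in> carrier (ideal_lattice P)"
    then have "I \<in> order_ideals P" "I' \<in> order_ideals P"
      by (simp_all add: ideal_lattice_def)
    from closed[OF this] this
    have "least (ideal_lattice P) (I \<union> I') (Upper (ideal_lattice P) {I, I'})"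
      and "greatest (ideal_lattice P) (I \<inter> I') (Lower (ideal_lattice P) {I, I'})"
      by (auto simp: ideal_lattice_def least_def greatest_def Upper_def Lower_def)
    then show "\<exists>s. least (ideal_lattice P) s (Upper (ideal_lattice P) {I, I'})"
      and "\<exists>s. greatest (ideal_lattice P) s (Lower (ideal_lattice P) {I, I'})"
      by blast+
  qed
qed


section \<open>The Ungarian Markov chain\<close>

definition covered :: "('a, 'b) gorder_scheme \<Rightarrow> 'a \<Rightarrow> 'a set" where
  "covered L x =
     {y \<in> carrier L. y \<sqsubset>\<^bsub>L\<^esub> x \<and> \<not> (\<exists>z\<in>carrier L. y \<sqsubset>\<^bsub>L\<^esub> z \<and> z \<sqsubset>\<^bsub>L\<^esub> x)}"

definition random_subset :: "real \<Rightarrow> 'a set \<Rightarrow> 'a set pmf" where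
  "random_subset p A = map_pmf (\<lambda>f. {x \<in> A. f x}) (Pi_pmf A False (\<lambda>_. bernoulli_pmf p))"

definition ungarian_step :: "real \<Rightarrow> ('a, 'b) gorder_scheme \<Rightarrow> 'a \<Rightarrow> 'a pmf" where
  "ungarian_step p L x = map_pmf (\<lambda>T. \<Sqinter>\<^bsub>L\<^esub> ({x} \<union> T)) (random_subset p (covered L x))"

text \<open>
  The law, on the space of trajectories, of the time-homogeneous Markov chain with transition
  kernel \<open>K\<close> started in \<open>s\<close>, obtained from the Ionescu-Tulcea construction. The \<open>n\<close>-th kernel
  of the construction gives the law of the state at time \<open>n\<close> from the states before time \<open>n\<close>.
\<close>

definition markov_kernel :: "('a \<Rightarrow> 'a pmf) \<Rightarrow> 'a \<Rightarrow> nat \<Rightarrow> (nat \<Rightarrow> 'a) \<Rightarrow> 'a measure" where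
  "markov_kernel K s n \<omega> =
     (case n of 0 \<Rightarrow> measure_pmf (return_pmf s) | Suc m \<Rightarrow> measure_pmf (K (\<omega> m)))"

definition markov_chain :: "('a \<Rightarrow> 'a pmf) \<Rightarrow> 'a \<Rightarrow> (nat \<Rightarrow> 'a) measure" where
  "markov_chain K s =
     projective_family.lim UNIV
       (Ionescu_Tulcea.CI (markov_kernel K s) (\<lambda>_. count_space UNIV))
       (\<lambda>_. count_space UNIV)"

lemma Ionescu_Tulcea_markov_kernel:
  "Ionescu_Tulcea (markov_kernel K s) (\<lambda>_. count_space UNIV)"
proof (rule Ionescu_Tulcea.intro)
  fix i :: nat
  show "markov_kernel K s i \<in>
      Pi\<^sub>M {0..<i} (\<lambda>_. count_space UNIV) \<rightarrow>\<^sub>M subprob_algebra (count_space UNIV)"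
  proof (cases i)
    case 0
    then show ?thesis
      by (simp add: markov_kernel_def [abs_def] measure_pmf_in_subprob_algebra)
  next
    case (Suc m)
    have "(\<lambda>\<omega>. \<omega> m) \<in> Pi\<^sub>M {0..<Suc m} (\<lambda>_. count_space UNIV) \<rightarrow>\<^sub>M (count_space UNIV :: 'a measure)"
      by (rule measurable_component_singleton) simp
    moreover have "(\<lambda>x. measure_pmf (K x)) \<in> count_space UNIV \<rightarrow>\<^sub>M subprob_algebra (count_space UNIV)"
      by (simp add: measure_pmf_in_subprob_algebra)
    ultimately show ?thesis
      unfolding Suc markov_kernel_def [abs_def] nat.case by (rule measurable_compose)
  qed
next
  show "prob_space (markov_kernel K s i \<omega>)" for i \<omega>
    unfolding markov_kernel_def by (cases i) (simp_all add: prob_space_measure_pmf)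
qed

text \<open>The infimum of the empty set is \<open>\<infinity>\<close>: a trajectory that misses \<open>x\<close> has infinite hitting time.\<close>

definition hitting_time :: "'a \<Rightarrow> (nat \<Rightarrow> 'a) \<Rightarrow> ennreal" where
  "hitting_time x \<omega> = (INF t\<in>{t. \<omega> t = x}. of_nat t)"

definition expected_steps :: "real \<Rightarrow> ('a, 'b) gorder_scheme \<Rightarrow> ennreal" where
  "expected_steps p L =
     (\<integral>\<^sup>+\<omega>. hitting_time \<bottom>\<^bsub>L\<^esub> \<omega> \<partial>markov_chain (ungarian_step p L) \<top>\<^bsub>L\<^esub>)"

end

(*
  For x > 0 give an order ideal I the weight W(I), the sum of (1 + x)^|C| over the maximal chains C
  of I. A maximal chain of an ideal J contained in I is the trace on J of a maximal chain of I, and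
  every maximal chain of I contains a maximal element of I, which the Ungarian step removes with
  probability p. Hence one step multiplies the expected weight by at most 1 - theta, where
  theta = p x / (1 + x), so by ln t <= t - 1 the function ln W / theta drops by at least 1 in
  expectation, and its value at the top bounds the expected hitting time of the bottom. That value is
  at most (ln |MC(P)| + max_chain_size P * ln (1 + x)) / theta. The constant of the theorem comes
  from the x with mu * x^2 = 2 * ln Gamma * (1 + x), by ln (1 + x) <= x - x^2 / (2 (1 + x)); for
  Gamma = 1 this x is 0 and one lets x tend to 0 instead.
*)
theory Submission
  imports Defs
begin

section \<open>One-time laws of the chain and a drift bound for hitting times\<close>

primrec state_law :: "('a \<Rightarrow> 'a pmf) \<Rightarrow> 'a \<Rightarrow> nat \<Rightarrow> 'a pmf" where
  "state_law K s 0 = return_pmf s"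
| "state_law K s (Suc n) = bind_pmf (state_law K s n) K"

text \<open>Coordinate \<open>n\<close> depends on finitely many stages of the construction, and
  integrating out the last kernel at each stage is what \<open>bind_pmf\<close> does. Expectations
  over trajectories thus become expectations under a \<open>pmf\<close>.\<close>

lemma nn_integral_markov_chain:
  "(\<integral>\<^sup>+\<omega>. f (\<omega> n) \<partial>markov_chain K s) = (\<integral>\<^sup>+x. f x \<partial>state_law K s n)"
proof -
  interpret IT: Ionescu_Tulcea "markov_kernel K s" "\<lambda>_. count_space UNIV"
    by (rule Ionescu_Tulcea_markov_kernel)
  let ?M = "\<lambda>_::nat. count_space UNIV :: 'a measure"
  \<comment> \<open>The product over the empty index set has a single point, the history before time
    0.\<close>
  define u where "u = (\<lambda>_::nat. undefined :: 'a)"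
  have u: "u \<in> space (Pi\<^sub>M {0..<0} ?M)"
    by (simp add: u_def space_PiM)
  have kernel_Suc: "markov_kernel K s (Suc n) \<omega> = measure_pmf (K (\<omega> n))" for n \<omega>
    by (simp add: markov_kernel_def)
  have component: "(\<lambda>\<omega>. g (\<omega> n)) \<in> borel_measurable (Pi\<^sub>M {0..<Suc n} ?M)"
    for g :: "'a \<Rightarrow> ennreal" and n
    by (rule measurable_compose[where N="count_space UNIV"])
       (rule measurable_component_singleton, simp_all)
  \<comment> \<open>Off by one: stage \<open>Suc n\<close> fixes the coordinates 0 to
    \<open>n\<close>, so coordinate \<open>n\<close> is drawn last, by the kernel with index
    \<open>n\<close>.\<close>
  have C_Suc: "(\<integral>\<^sup>+\<omega>. g (\<omega> n) \<partial>IT.C 0 (Suc n) u) =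
      (\<integral>\<^sup>+\<omega>. \<integral>\<^sup>+x. g x \<partial>markov_kernel K s n \<omega> \<partial>IT.C 0 n u)" for g n
  proof -
    have "(\<integral>\<^sup>+\<omega>. g (\<omega> n) \<partial>IT.C 0 (Suc n) u) =
        (\<integral>\<^sup>+\<omega>. \<integral>\<^sup>+\<omega>'. g (\<omega>' n) \<partial>IT.eP n \<omega> \<partial>IT.C 0 n u)"
      using IT.measurable_eP[of n] component[of g n]
      by (simp, subst nn_integral_bind[where B="Pi\<^sub>M {0..<Suc n} ?M"])
         (simp_all cong: measurable_cong_sets add: measurable_cong_sets[OF IT.sets_C[OF u] refl])
    also have "\<dots> = (\<integral>\<^sup>+\<omega>. \<integral>\<^sup>+x. g x \<partial>markov_kernel K s n \<omega> \<partial>IT.C 0 n u)"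
      by (intro nn_integral_cong) (simp add: IT.space_C[OF u] IT.nn_integral_eP component)
    finally show ?thesis .
  qed
  \<comment> \<open>The function \<open>g\<close> must vary in the induction: the last kernel is
    absorbed into it.\<close>
  have C: "(\<integral>\<^sup>+\<omega>. g (\<omega> n) \<partial>IT.C 0 (Suc n) u) = (\<integral>\<^sup>+x. g x \<partial>state_law K s n)" for g n
  proof (induction n arbitrary: g)
    case 0
    show ?case
      unfolding C_Suc using prob_space.emeasure_space_1[OF IT.prob_space_C[OF u, of 0]]
      by (simp add: markov_kernel_def)
  next
    case (Suc n)
    show ?case
      unfolding C_Suc[where n="Suc n"] using Suc[of "\<lambda>y. \<integral>\<^sup>+x. g x \<partial>K y"]
      by (simp add: kernel_Suc del: IT.C.simps)
  qed
  \<comment> \<open>Restricting to a finite index set containing \<open>n\<close> leaves the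
    integrand unchanged and turns the projective limit into a finite-dimensional marginal.\<close>
  have "(\<integral>\<^sup>+\<omega>. f (\<omega> n) \<partial>markov_chain K s) =
      (\<integral>\<^sup>+\<omega>. f ((restrict \<omega> {0..<Suc n}) n) \<partial>IT.PF.lim)"
    unfolding markov_chain_def by simp
  also have "\<dots> = (\<integral>\<^sup>+\<omega>. f (\<omega> n) \<partial>distr IT.PF.lim (Pi\<^sub>M {0..<Suc n} ?M) (\<lambda>\<omega>. restrict \<omega> {0..<Suc n}))"
    by (subst nn_integral_distr)
       (simp_all add: component measurable_cong_sets[OF IT.PF.sets_lim refl] measurable_restrict_subset)
  also have "\<dots> = (\<integral>\<^sup>+\<omega>. f (\<omega> n) \<partial>IT.CI {0..<Suc n})"
    by (subst IT.distr_lim) simp_all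
  also have "\<dots> = (\<integral>\<^sup>+\<omega>. f (\<omega> n) \<partial>IT.C 0 (Suc n) u)"
  proof -
    have "IT.up_to {0..<Suc n} = Suc n"
      by (rule antisym) (use IT.up_to_less[of "{0..<Suc n}" n] in \<open>simp_all add: IT.up_to_iff Suc_le_eq\<close>)
    then show ?thesis
      unfolding IT.CI_def u_def
      by (subst nn_integral_distr)
         (simp_all add: component measurable_cong_sets[OF IT.sets_C refl] measurable_restrict_subset
            space_PiM del: IT.C.simps)
  qed
  finally show ?thesis
    by (simp add: C del: IT.C.simps)
qed

text \<open>Each time before the first visit contributes one to the sum; if there is no visit, both
  sides are infinite. Later departures from \<open>x\<close> only enlarge the sum.\<close>

lemma hitting_time_le_suminf: "hitting_time x \<omega> \<le> (\<Sum>t. indicator (- {x}) (\<omega> t))"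
proof (cases "\<exists>t. \<omega> t = x")
  case True
  define T where "T = (LEAST t. \<omega> t = x)"
  have "hitting_time x \<omega> \<le> of_nat T"
    unfolding hitting_time_def T_def using True by (intro INF_lower) (auto intro: LeastI_ex)
  also have "\<dots> = (\<Sum>t<T. indicator (- {x}) (\<omega> t))"
  proof -
    have "indicator (- {x}) (\<omega> t) = (1 :: ennreal)" if "t < T" for t
      using not_less_Least[OF that[unfolded T_def]] by simp
    then show ?thesis by simp
  qed
  also have "\<dots> \<le> (\<Sum>t. indicator (- {x}) (\<omega> t))"
    by (rule sum_le_suminf) auto
  finally show ?thesis .
next
  case False
  have "of_nat N \<le> (\<Sum>t. indicator (- {x}) (\<omega> t) :: ennreal)" for N
    using sum_le_suminf[of "\<lambda>t. indicator (- {x}) (\<omega> t) :: ennreal" "{..<N}"] False by simp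
  then have "(SUP N. of_nat N) \<le> (\<Sum>t. indicator (- {x}) (\<omega> t) :: ennreal)"
    by (rule SUP_least)
  then show ?thesis
    by (simp add: ennreal_SUP_of_nat_eq_top top_unique)
qed

text \<open>A Foster-Lyapunov argument: \<open>h\<close> pays one unit in expectation for every step
  begun away from \<open>x\<close>, and its initial value is the whole budget. The closed set
  \<open>S\<close> confines the hypotheses to the states that can occur.\<close>

lemma nn_integral_hitting_time_le:
  fixes h :: "'a \<Rightarrow> ennreal"
  assumes "s \<in> S" and S: "\<And>y. y \<in> S \<Longrightarrow> set_pmf (K y) \<subseteq> S"
    and drift: "\<And>y. y \<in> S \<Longrightarrow> y \<noteq> x \<Longrightarrow> (\<integral>\<^sup>+z. h z \<partial>K y) + 1 \<le> h y"
    and absorbing: "x \<in> S \<Longrightarrow> (\<integral>\<^sup>+z. h z \<partial>K x) \<le> h x"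
  shows "(\<integral>\<^sup>+\<omega>. hitting_time x \<omega> \<partial>markov_chain K s) \<le> h s"
proof -
  let ?L = "state_law K s"
  have law: "set_pmf (?L n) \<subseteq> S" for n
    using assms(1) S by (induction n) auto
  \<comment> \<open>The unspent budget at time \<open>n\<close> stays on the left to carry the
    induction; being nonnegative, it is dropped in the end.\<close>
  have telescope: "(\<Sum>t<n. \<integral>\<^sup>+y. indicator (- {x}) y \<partial>?L t) + (\<integral>\<^sup>+y. h y \<partial>?L n) \<le> h s" for n
  proof (induction n)
    case (Suc n)
    have "(\<integral>\<^sup>+y. indicator (- {x}) y \<partial>?L n) + (\<integral>\<^sup>+y. h y \<partial>?L (Suc n)) =
        (\<integral>\<^sup>+y. indicator (- {x}) y + (\<integral>\<^sup>+z. h z \<partial>K y) \<partial>?L n)"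
      by (simp add: nn_integral_add)
    also have "\<dots> \<le> (\<integral>\<^sup>+y. h y \<partial>?L n)"
      using law[of n] drift absorbing
      by (intro nn_integral_mono_AE AE_pmfI) (auto simp: add.commute split: split_indicator)
    finally show ?case
      using Suc.IH by (simp add: add.assoc) (meson add_left_mono order_trans)
  qed simp
  have "(\<integral>\<^sup>+\<omega>. hitting_time x \<omega> \<partial>markov_chain K s) \<le>
      (\<integral>\<^sup>+\<omega>. (\<Sum>t. indicator (- {x}) (\<omega> t)) \<partial>markov_chain K s)"
    by (intro nn_integral_mono hitting_time_le_suminf)
  also have "\<dots> = (\<Sum>t. \<integral>\<^sup>+\<omega>. indicator (- {x}) (\<omega> t) \<partial>markov_chain K s)"
  proof (rule nn_integral_suminf)
    interpret IT: Ionescu_Tulcea "markov_kernel K s" "\<lambda>_. count_space UNIV"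
      by (rule Ionescu_Tulcea_markov_kernel)
    fix t
    show "(\<lambda>\<omega>. indicator (- {x}) (\<omega> t) :: ennreal) \<in> borel_measurable (markov_chain K s)"
      unfolding markov_chain_def measurable_cong_sets[OF IT.PF.sets_lim refl]
      by (rule measurable_compose[where N="count_space UNIV"])
         (rule measurable_component_singleton, simp_all)
  qed
  also have "\<dots> = (\<Sum>t. \<integral>\<^sup>+y. indicator (- {x}) y \<partial>?L t)"
    by (simp only: nn_integral_markov_chain)
  also have "\<dots> \<le> h s"
    by (rule suminf_le_const[OF summableI order_trans[OF add_increasing2[OF zero_le order_refl] telescope]])
  finally show ?thesis .
qed

section \<open>Maximal chains of finite sets and their weights\<close>

definition chain_weight :: "('a \<Rightarrow> 'a \<Rightarrow> bool) \<Rightarrow> real \<Rightarrow> 'a set \<Rightarrow> real" where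
  "chain_weight R m A = (\<Sum>C\<in>{C. pred_on.maxchain A R C}. m ^ card C)"

lemma finite_maxchains: "finite A \<Longrightarrow> finite {C. pred_on.maxchain A R C}"
  by (rule finite_subset[of _ "Pow A"]) (auto simp: pred_on.maxchain_def pred_on.chain_def)

lemma chain_mono: "pred_on.chain A R C \<Longrightarrow> A \<subseteq> B \<Longrightarrow> pred_on.chain B R C"
  by (auto simp: pred_on.chain_def)

lemma chain_Int: "pred_on.chain A R C \<Longrightarrow> pred_on.chain B R (C \<inter> B)"
  by (auto simp: pred_on.chain_def)

lemma maxchainD: "pred_on.maxchain A R C \<Longrightarrow> pred_on.chain A R C"
  by (simp add: pred_on.maxchain_def)

lemma maxchain_maximal:
  "pred_on.maxchain A R C \<Longrightarrow> pred_on.chain A R D \<Longrightarrow> C \<subseteq> D \<Longrightarrow> D = C"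
  by (auto simp: pred_on.maxchain_def)

lemma chain_extends_to_maxchain:
  assumes "finite A" and "pred_on.chain A R C"
  obtains D where "pred_on.maxchain A R D" and "C \<subseteq> D"
proof -
  have "finite {D. pred_on.chain A R D}"
    by (rule finite_subset[of _ "Pow A"]) (use assms in \<open>auto simp: pred_on.chain_def\<close>)
  from finite_has_maximal2[OF this, of C] assms(2) obtain D where
    "pred_on.chain A R D" "C \<subseteq> D" "\<And>E. pred_on.chain A R E \<Longrightarrow> D \<subseteq> E \<Longrightarrow> D = E"
    by auto
  then show thesis
    using that[of D] unfolding pred_on.maxchain_def by blast
qed

text \<open>Some maximal chain exists (the empty one if \<open>A\<close> is empty), and its term
  alone is at least one. So \<open>ln\<close> of the weight is nonnegative and is not truncated when
  cast to \<open>ennreal\<close>.\<close>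

lemma chain_weight_ge_1:
  assumes "finite A" and "1 \<le> m"
  shows "1 \<le> chain_weight R m A"
proof -
  obtain D where D: "pred_on.maxchain A R D"
    using chain_extends_to_maxchain[OF assms(1) pred_on.chain_empty] .
  have "1 \<le> m ^ card D"
    using assms(2) by simp
  also have "\<dots> \<le> chain_weight R m A"
    unfolding chain_weight_def using D assms by (intro member_le_sum finite_maxchains) auto
  finally show ?thesis .
qed

text \<open>Extend each maximal chain of \<open>B\<close> to a maximal chain of \<open>A\<close>.
  The trace of the extension on \<open>B\<close> is a chain containing the original one, hence equal
  to it; so extending is injective.\<close>

lemma chain_weight_subset_le:
  assumes "finite A" and "B \<subseteq> A" and "0 \<le> m"
  shows "chain_weight R m B \<le> (\<Sum>D\<in>{D. pred_on.maxchain A R D}. m ^ card (D \<inter> B))"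
proof -
  have "\<exists>D. pred_on.maxchain A R D \<and> D \<inter> B = C" if C: "pred_on.maxchain B R C" for C
  proof -
    have "pred_on.chain A R C"
      using maxchainD[OF C] assms(2) by (rule chain_mono)
    then obtain D where D: "pred_on.maxchain A R D" "C \<subseteq> D"
      using chain_extends_to_maxchain[OF assms(1)] by blast
    have "pred_on.chain B R (D \<inter> B)"
      using maxchainD[OF D(1)] by (rule chain_Int)
    moreover have "C \<subseteq> D \<inter> B"
      using maxchainD[OF C] D(2) by (auto simp: pred_on.chain_def)
    ultimately have "D \<inter> B = C"
      by (rule maxchain_maximal[OF C])
    with D show ?thesis by blast
  qed
  then obtain g where g: "\<And>C. pred_on.maxchain B R C \<Longrightarrow> pred_on.maxchain A R (g C) \<and> g C \<inter> B = C"
    by metis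
  have "inj_on g {C. pred_on.maxchain B R C}"
    by (rule inj_onI) (use g in \<open>metis mem_Collect_eq\<close>)
  then have "chain_weight R m B = (\<Sum>D\<in>g ` {C. pred_on.maxchain B R C}. m ^ card (D \<inter> B))"
    using g by (simp add: sum.reindex chain_weight_def)
  also have "\<dots> \<le> (\<Sum>D\<in>{D. pred_on.maxchain A R D}. m ^ card (D \<inter> B))"
    using g assms by (intro sum_mono2 finite_maxchains) auto
  finally show ?thesis .
qed

text \<open>The greatest element of \<open>D\<close> works: anything of \<open>A\<close> strictly
  above it could be added to \<open>D\<close>.\<close>

lemma (in partial_order) maxchain_has_maximal:
  assumes A: "finite A" "A \<subseteq> carrier L" "A \<noteq> {}" and D: "pred_on.maxchain A (le L) D"
  shows "\<exists>x\<in>D. \<forall>z\<in>A. x \<sqsubseteq> z \<longrightarrow> z = x"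
proof -
  have DA: "D \<subseteq> A"
    using D by (auto simp: pred_on.maxchain_def pred_on.chain_def)
  \<comment> \<open>\<open>pred_on.chain\<close> compares elements by the reflexive closure of the
    relation, so equal elements need \<open>le_refl\<close> separately.\<close>
  have total: "x \<sqsubseteq> y \<or> y \<sqsubseteq> x" if "x \<in> D" "y \<in> D" for x y
  proof (cases "x = y")
    case True
    with that DA A(2) le_refl show ?thesis by blast
  next
    case False
    with maxchainD[OF D] that show ?thesis by (auto simp: pred_on.chain_def)
  qed
  have "D \<noteq> {}"
  proof
    assume "D = {}"
    moreover obtain a where "a \<in> A" using A(3) by blast
    moreover from this have "pred_on.chain A (le L) {a}"
      by (simp add: pred_on.chain_def)
    ultimately show False
      using maxchain_maximal[OF D] by blast
  qed
  \<comment> \<open>Stated for all nonempty finite subsets so that induction applies; used for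
    \<open>D\<close> itself.\<close>
  have "\<exists>x\<in>E. \<forall>y\<in>E. y \<sqsubseteq> x" if "finite E" "E \<noteq> {}" "E \<subseteq> D" for E
    using that
  proof (induction rule: finite_ne_induct)
    case (singleton a)
    then show ?case using DA A(2) le_refl by auto
  next
    case (insert a E)
    then obtain x where x: "x \<in> E" "\<forall>y\<in>E. y \<sqsubseteq> x" by auto
    show ?case
    proof (cases "a \<sqsubseteq> x")
      case True
      with x show ?thesis by blast
    next
      case False
      with total[of a x] x insert.prems have xa: "x \<sqsubseteq> a" by auto
      have "y \<sqsubseteq> a" if "y \<in> insert a E" for y
        using that
      proof
        assume "y \<in> E"
        with x xa insert.prems DA A(2) show ?thesis by (meson insert_subset le_trans subset_iff)
      qed (use insert.prems DA A(2) le_refl in auto)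
      then show ?thesis by blast
    qed
  qed
  from this[OF finite_subset[OF DA A(1)] \<open>D \<noteq> {}\<close> subset_refl]
  obtain x where x: "x \<in> D" "\<And>y. y \<in> D \<Longrightarrow> y \<sqsubseteq> x" by blast
  have "z = x" if z: "z \<in> A" "x \<sqsubseteq> z" for z
  proof (cases "z \<in> D")
    case True
    with x z DA A(2) show ?thesis by (meson le_antisym subset_iff)
  next
    case False
    have "y \<sqsubseteq> z" if "y \<in> D" for y
      using x that z DA A(2) by (meson le_trans subset_iff)
    then have "pred_on.chain A (le L) (insert z D)"
      using maxchainD[OF D] z(1) by (auto simp: pred_on.chain_def)
    with maxchain_maximal[OF D] False show ?thesis by blast
  qed
  with x(1) show ?thesis by blast
qed

section \<open>The lattice of order ideals and the Ungarian step on it\<close>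

lemma finite_order_ideals: "finite (carrier P) \<Longrightarrow> finite (order_ideals P)"
  by (rule finite_subset[of _ "Pow (carrier P)"]) (auto simp: order_ideals_def)

lemma top_ideal_lattice: "\<top>\<^bsub>ideal_lattice P\<^esub> = carrier P"
  unfolding top_def
  by (rule some_equality) (auto simp: greatest_def ideal_lattice_def order_ideals_def)

lemma bottom_ideal_lattice: "\<bottom>\<^bsub>ideal_lattice P\<^esub> = {}"
  unfolding bottom_def
  by (rule some_equality) (auto simp: least_def ideal_lattice_def order_ideals_def)

lemma Inter_order_ideals:
  assumes "I \<in> order_ideals P" and "T \<subseteq> order_ideals P"
  shows "\<Inter> ({I} \<union> T) \<in> order_ideals P"
proof -
  have "y \<in> J" if "J \<in> {I} \<union> T" "x \<in> J" "y \<in> carrier P" "le P y x" for J x y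
  proof -
    have "J \<in> order_ideals P"
      using that(1) assms by auto
    with that(2-) show ?thesis
      by (auto simp: order_ideals_def)
  qed
  then show ?thesis
    using assms(1) by (auto simp: order_ideals_def)
qed

text \<open>The meet is a Hilbert choice among greatest lower bounds, and the intersection is the
  only candidate. The member \<open>I\<close> keeps it inside the carrier.\<close>

lemma inf_ideal_lattice:
  assumes "I \<in> order_ideals P" and "T \<subseteq> order_ideals P"
  shows "\<Sqinter>\<^bsub>ideal_lattice P\<^esub> ({I} \<union> T) = \<Inter> ({I} \<union> T)"
proof -
  have member: "J \<in> order_ideals P" if "J \<in> {I} \<union> T" for J
    using that assms by auto
  have "greatest (ideal_lattice P) X (Lower (ideal_lattice P) ({I} \<union> T)) \<longleftrightarrow> X = \<Inter> ({I} \<union> T)" for X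
  proof -
    have "Lower (ideal_lattice P) ({I} \<union> T) = {X \<in> order_ideals P. X \<subseteq> \<Inter> ({I} \<union> T)}"
      using member by (simp add: Lower_def ideal_lattice_def) blast
    then show ?thesis
      using Inter_order_ideals[OF assms] by (simp add: greatest_def ideal_lattice_def) blast
  qed
  then show ?thesis
    by (simp add: Lattice.inf_def)
qed

lemma covered_ideal_lattice_subset: "covered (ideal_lattice P) I \<subseteq> order_ideals P"
  by (auto simp: covered_def ideal_lattice_def)

text \<open>Nothing of \<open>I\<close> lies above \<open>x\<close>, so the set stays down-closed,
  and no set fits strictly between \<open>I\<close> and \<open>I\<close> without one
  element.\<close>

lemma (in partial_order) remove_maximal_in_covered:
  assumes I: "I \<in> order_ideals L" and x: "x \<in> I" and max: "\<And>z. z \<in> I \<Longrightarrow> x \<sqsubseteq> z \<Longrightarrow> z = x"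
  shows "I - {x} \<in> covered (ideal_lattice L) I"
proof -
  have "I - {x} \<in> order_ideals L"
    using assms unfolding order_ideals_def by blast
  then show ?thesis
    using x by (auto simp: covered_def ideal_lattice_def lless_def)
qed

lemma set_random_subset: "finite A \<Longrightarrow> T \<in> set_pmf (random_subset p A) \<Longrightarrow> T \<subseteq> A"
  by (auto simp: random_subset_def)

lemma finite_set_random_subset: "finite A \<Longrightarrow> finite (set_pmf (random_subset p A))"
  by (rule finite_subset[of _ "Pow A"]) (auto dest: set_random_subset)

text \<open>Membership of one element is one Bernoulli coordinate. The drift estimate reads the
  random set through these marginals, one covered ideal per maximal chain.\<close>

lemma random_subset_member:
  "finite A \<Longrightarrow> a \<in> A \<Longrightarrow> map_pmf (\<lambda>T. a \<in> T) (random_subset p A) = bernoulli_pmf p"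
  by (simp add: random_subset_def pmf.map_comp comp_def Pi_pmf_component)

lemma expectation_random_subset_member:
  assumes "finite A" and "a \<in> A" and "0 \<le> p" and "p \<le> 1"
  shows "measure_pmf.expectation (random_subset p A) (\<lambda>T. if a \<in> T then c else d) = p * c + (1 - p) * d"
proof -
  have "measure_pmf.expectation (random_subset p A) (\<lambda>T. if a \<in> T then c else d) =
      measure_pmf.expectation (map_pmf (\<lambda>T. a \<in> T) (random_subset p A)) (\<lambda>b. if b then c else d)"
    by simp
  also have "\<dots> = p * c + (1 - p) * d"
    using assms by (simp only: random_subset_member) (simp add: algebra_simps)
  finally show ?thesis .
qed

lemma finite_covered_ideal_lattice: "finite (carrier P) \<Longrightarrow> finite (covered (ideal_lattice P) I)"
  using covered_ideal_lattice_subset finite_order_ideals by (rule finite_subset)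

lemma set_random_subset_covered:
  "finite (carrier P) \<Longrightarrow> T \<in> set_pmf (random_subset p (covered (ideal_lattice P) I)) \<Longrightarrow>
    T \<subseteq> order_ideals P"
  using set_random_subset[OF finite_covered_ideal_lattice] covered_ideal_lattice_subset
  by (rule order_trans)

lemma ungarian_step_ideal_lattice:
  assumes "finite (carrier P)" and "I \<in> order_ideals P"
  shows "ungarian_step p (ideal_lattice P) I =
    map_pmf (\<lambda>T. \<Inter> ({I} \<union> T)) (random_subset p (covered (ideal_lattice P) I))"
  unfolding ungarian_step_def
  by (intro map_pmf_cong refl inf_ideal_lattice set_random_subset_covered assms)

text \<open>Gives both the closed state space for the drift bound and, through
  \<open>J \<subseteq> I\<close>, the absorption at the empty ideal.\<close>

lemma set_ungarian_step_ideal_lattice: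
  assumes "finite (carrier P)" and "I \<in> order_ideals P"
  shows "set_pmf (ungarian_step p (ideal_lattice P) I) \<subseteq> {J \<in> order_ideals P. J \<subseteq> I}"
proof
  fix J assume "J \<in> set_pmf (ungarian_step p (ideal_lattice P) I)"
  then obtain T where J: "J = \<Inter> ({I} \<union> T)"
    and T: "T \<in> set_pmf (random_subset p (covered (ideal_lattice P) I))"
    unfolding ungarian_step_ideal_lattice[OF assms] by auto
  have "J \<in> order_ideals P"
    unfolding J using Inter_order_ideals[OF assms(2) set_random_subset_covered[OF assms(1) T]] .
  then show "J \<in> {J \<in> order_ideals P. J \<subseteq> I}"
    using J by simp
qed

section \<open>Drift of the logarithmic chain weight\<close>

lemma (in partial_order) chain_weight_drift:
  fixes p x :: real
  assumes fin: "finite (carrier L)" and p: "0 < p" "p \<le> 1" and x: "0 < x"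
    and I: "I \<in> order_ideals L" "I \<noteq> {}"
  defines "\<theta> \<equiv> p * x / (1 + x)" and "W \<equiv> chain_weight (le L) (1 + x)"
  shows "(\<integral>\<^sup>+J. ennreal (ln (W J) / \<theta>) \<partial>ungarian_step p (ideal_lattice L) I) + 1 \<le> ennreal (ln (W I) / \<theta>)"
proof -
  let ?cov = "covered (ideal_lattice L) I"
  let ?M = "random_subset p ?cov"
  let ?J = "\<lambda>T. \<Inter> ({I} \<union> T)"
  let ?\<M> = "{D. pred_on.maxchain I (le L) D}"
  have IL: "I \<subseteq> carrier L"
    using I by (simp add: order_ideals_def)
  have finI: "finite I"
    using IL fin by (rule finite_subset)
  have fin_cov: "finite ?cov"
    using fin by (rule finite_covered_ideal_lattice)
  have int: "integrable (measure_pmf ?M) f" for f :: "_ \<Rightarrow> real"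
    by (rule integrable_measure_pmf_finite[OF finite_set_random_subset[OF fin_cov]])
  have W1: "1 \<le> W J" if "J \<subseteq> I" for J
    unfolding W_def using finite_subset[OF that finI] x by (intro chain_weight_ge_1) auto
  have \<theta>: "0 < \<theta>"
    using p x by (simp add: \<theta>_def)
  have "\<exists>t. t \<in> D \<and> I - {t} \<in> ?cov" if D: "D \<in> ?\<M>" for D
  proof -
    from D have D: "pred_on.maxchain I (le L) D" by simp
    from maxchain_has_maximal[OF finI IL I(2) D] obtain t
      where t: "t \<in> D" and max: "\<And>z. z \<in> I \<Longrightarrow> t \<sqsubseteq> z \<Longrightarrow> z = t"
      by blast
    have "t \<in> I"
      using maxchainD[OF D] t by (auto simp: pred_on.chain_def)
    then have "I - {t} \<in> ?cov"
      using max by (rule remove_maximal_in_covered[OF I(1)])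
    with t show ?thesis by blast
  qed
  \<comment> \<open>For each maximal chain \<open>D\<close>, one maximal element of \<open>I\<close>
    on it is fixed before \<open>T\<close> is drawn.\<close>
  then obtain t where t: "\<And>D. D \<in> ?\<M> \<Longrightarrow> t D \<in> D \<and> I - {t D} \<in> ?cov"
    by metis
  \<comment> \<open>An upper bound for the term of \<open>D\<close> after the step: one factor
    \<open>1 + x\<close> is lost if \<open>t D\<close> is removed, and any further removals are
    ignored.\<close>
  define g where "g T D = (if I - {t D} \<in> T then (1 + x) ^ card D / (1 + x) else (1 + x) ^ card D)" for T D
  have W_le: "W (?J T) \<le> (\<Sum>D\<in>?\<M>. g T D)" for T
  proof -
    have "W (?J T) \<le> (\<Sum>D\<in>?\<M>. (1 + x) ^ card (D \<inter> ?J T))"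
      unfolding W_def using finI x by (intro chain_weight_subset_le) auto
    also have "\<dots> \<le> (\<Sum>D\<in>?\<M>. g T D)"
    proof (rule sum_mono)
      fix D assume D: "D \<in> ?\<M>"
      then have finD: "finite D"
        using finI finite_subset by (auto simp: pred_on.maxchain_def pred_on.chain_def)
      show "(1 + x) ^ card (D \<inter> ?J T) \<le> g T D"
      proof (cases "I - {t D} \<in> T")
        case True
        have "card (D \<inter> ?J T) \<le> card (D - {t D})"
          using True finD by (intro card_mono) auto
        then have "(1 + x) ^ card (D \<inter> ?J T) \<le> (1 + x) ^ card (D - {t D})"
          using x by (intro power_increasing) auto
        also have "\<dots> = (1 + x) ^ card D / (1 + x)"
          using card_Suc_Diff1[OF finD, of "t D"] t[OF D] x by (simp add: field_simps flip: power_Suc)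
        finally show ?thesis
          using True by (simp add: g_def)
      next
        case False
        have "(1 + x) ^ card (D \<inter> ?J T) \<le> (1 + x) ^ card D"
          using x finD by (intro power_increasing card_mono) auto
        then show ?thesis
          using False by (simp add: g_def)
      qed
    qed
    finally show ?thesis .
  qed
  have "measure_pmf.expectation ?M (\<lambda>T. \<Sum>D\<in>?\<M>. g T D) = (\<Sum>D\<in>?\<M>. measure_pmf.expectation ?M (\<lambda>T. g T D))"
    using int by (intro Bochner_Integration.integral_sum) auto
  also have "\<dots> = (\<Sum>D\<in>?\<M>. (1 - \<theta>) * (1 + x) ^ card D)"
  proof (rule sum.cong[OF HOL.refl])
    fix D assume "D \<in> ?\<M>"
    then have "measure_pmf.expectation ?M (\<lambda>T. g T D) =
        p * ((1 + x) ^ card D / (1 + x)) + (1 - p) * (1 + x) ^ card D"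
      unfolding g_def using t p by (intro expectation_random_subset_member fin_cov) auto
    \<comment> \<open>This is where \<theta> comes from:
      \<open>p / (1 + x) + (1 - p) = 1 - \<theta>\<close>.\<close>
    also have "\<dots> = (1 - \<theta>) * (1 + x) ^ card D"
      using x by (simp add: \<theta>_def field_simps)
    finally show "measure_pmf.expectation ?M (\<lambda>T. g T D) = (1 - \<theta>) * (1 + x) ^ card D" .
  qed
  also have "\<dots> = (1 - \<theta>) * W I"
    by (simp add: W_def chain_weight_def sum_distrib_left)
  finally have Eg: "measure_pmf.expectation ?M (\<lambda>T. \<Sum>D\<in>?\<M>. g T D) = (1 - \<theta>) * W I" .
  have WI: "1 \<le> W I"
    by (rule W1) simp
  \<comment> \<open>The logarithm is replaced by its tangent at \<open>W I\<close>, so that the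
    expectation passes to the weight itself.\<close>
  have "measure_pmf.expectation ?M (\<lambda>T. ln (W (?J T))) \<le>
      measure_pmf.expectation ?M (\<lambda>T. ln (W I) - 1 + (\<Sum>D\<in>?\<M>. g T D) / W I)"
  proof (intro integral_mono int)
    fix T
    have WJ: "1 \<le> W (?J T)"
      by (rule W1) auto
    then have "ln (W (?J T)) - ln (W I) = ln (W (?J T) / W I)"
      using WI by (simp add: ln_div)
    also have "\<dots> \<le> W (?J T) / W I - 1"
      using WJ WI by (intro ln_le_minus_one) auto
    also have "\<dots> \<le> (\<Sum>D\<in>?\<M>. g T D) / W I - 1"
      using W_le[of T] WI by (intro diff_right_mono divide_right_mono) auto
    finally show "ln (W (?J T)) \<le> ln (W I) - 1 + (\<Sum>D\<in>?\<M>. g T D) / W I" by simp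
  qed
  also have "\<dots> = ln (W I) - 1 + measure_pmf.expectation ?M (\<lambda>T. \<Sum>D\<in>?\<M>. g T D) / W I"
    by (subst Bochner_Integration.integral_add) (use int in auto)
  also have "\<dots> = ln (W I) - \<theta>"
    using Eg WI by simp
  finally have E: "measure_pmf.expectation ?M (\<lambda>T. ln (W (?J T))) \<le> ln (W I) - \<theta>" .
  have nonneg: "0 \<le> ln (W (?J T)) / \<theta>" for T
    using W1[of "?J T"] \<theta> by (intro divide_nonneg_pos ln_ge_zero) auto
  have E0: "0 \<le> measure_pmf.expectation ?M (\<lambda>T. ln (W (?J T)) / \<theta>)"
    using nonneg by (rule Bochner_Integration.integral_nonneg)
  have "(\<integral>\<^sup>+J. ennreal (ln (W J) / \<theta>) \<partial>ungarian_step p (ideal_lattice L) I) + 1 =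
      (\<integral>\<^sup>+T. ennreal (ln (W (?J T)) / \<theta>) \<partial>?M) + 1"
    by (simp add: ungarian_step_ideal_lattice[OF fin I(1)])
  also have "\<dots> = ennreal (measure_pmf.expectation ?M (\<lambda>T. ln (W (?J T)) / \<theta>)) + ennreal 1"
    by (subst nn_integral_eq_integral[OF int]) (use nonneg in auto)
  also have "\<dots> = ennreal (measure_pmf.expectation ?M (\<lambda>T. ln (W (?J T)) / \<theta>) + 1)"
    using E0 by (intro ennreal_plus[symmetric]) auto
  also have "\<dots> \<le> ennreal (ln (W I) / \<theta>)"
    using divide_right_mono[OF E, of \<theta>] \<theta> by (intro ennreal_leI) (simp add: diff_divide_distrib)
  finally show ?thesis .
qed

text \<open>The drift bound with potential \<open>ln W / \<theta>\<close>, started at the full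
  carrier. The empty ideal has only itself as successor, so the potential is constant there.\<close>

lemma (in partial_order) expected_steps_ideal_lattice_le:
  fixes p x :: real
  assumes fin: "finite (carrier L)" and p: "0 < p" "p \<le> 1" and x: "0 < x"
  shows "expected_steps p (ideal_lattice L) \<le>
    ennreal (ln (chain_weight (le L) (1 + x) (carrier L)) / (p * x / (1 + x)))"
  unfolding expected_steps_def top_ideal_lattice bottom_ideal_lattice
proof (rule nn_integral_hitting_time_le[where S="order_ideals L"
      and h="\<lambda>J. ennreal (ln (chain_weight (le L) (1 + x) J) / (p * x / (1 + x)))"])
  show "carrier L \<in> order_ideals L"
    by (simp add: order_ideals_def)
  show "set_pmf (ungarian_step p (ideal_lattice L) I) \<subseteq> order_ideals L" if "I \<in> order_ideals L" for I
    using set_ungarian_step_ideal_lattice[OF fin that] by blast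
next
  assume "{} \<in> order_ideals L"
  from set_ungarian_step_ideal_lattice[OF fin this, of p]
  have "set_pmf (ungarian_step p (ideal_lattice L) {}) \<subseteq> {{}}"
    by auto
  then have "ungarian_step p (ideal_lattice L) {} = return_pmf {}"
    by (simp only: set_pmf_subset_singleton)
  then show "(\<integral>\<^sup>+J. ennreal (ln (chain_weight (le L) (1 + x) J) / (p * x / (1 + x)))
      \<partial>ungarian_step p (ideal_lattice L) {}) \<le>
      ennreal (ln (chain_weight (le L) (1 + x) {}) / (p * x / (1 + x)))"
    by simp
qed (use chain_weight_drift[OF fin p x] in auto)

section \<open>Real estimates behind the constant, and the logarithm of the top weight\<close>

lemma ln_add_one_le: "ln (1 + x) \<le> x - x\<^sup>2 / (2 * (1 + x))" if "0 \<le> x" for x :: real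
proof -
  \<comment> \<open>The claim with its denominator cleared; \<open>f\<close> vanishes at 0 and has
    derivative \<open>2 * (y - ln (1 + y))\<close> at \<open>y\<close>.\<close>
  define f where "f x = 2 * (1 + x) * (x - ln (1 + x)) - x\<^sup>2" for x :: real
  have "f 0 \<le> f x"
  proof (rule DERIV_nonneg_imp_nondecreasing[OF that])
    fix y :: real assume y: "0 \<le> y"
    then have "(f has_real_derivative 2 * (y - ln (1 + y))) (at y)"
      unfolding f_def by (auto intro!: derivative_eq_intros) (simp add: divide_simps; simp add: algebra_simps)
    moreover have "0 \<le> 2 * (y - ln (1 + y))"
      using ln_add_one_self_le_self[OF y] by simp
    ultimately show "\<exists>d. (f has_real_derivative d) (at y) \<and> 0 \<le> d"
      by blast
  qed
  then have "x\<^sup>2 / (2 * (1 + x)) \<le> x - ln (1 + x)"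
    using that by (simp add: f_def pos_divide_le_eq mult.commute)
  then show ?thesis by simp
qed

text \<open>The lower bound on \<open>x\<close> is the larger root of
  \<open>\<mu> * x^2 = 2 * c * (1 + x)\<close>. From there on \<open>c\<close> is at most \<mu>
  times the quadratic gain in \<open>ln_add_one_le\<close>, whence
  \<open>c + \<mu> * ln (1 + x) \<le> \<mu> * x\<close>.\<close>

lemma chernoff_rate:
  fixes c \<mu> x :: real
  assumes "0 \<le> c" and "0 < \<mu>" and "0 < x" and x: "(c + sqrt (2 * \<mu> * c + c\<^sup>2)) / \<mu> \<le> x"
  shows "(c + \<mu> * ln (1 + x)) * (1 + x) / x \<le> \<mu> * (1 + x)"
proof -
  have "sqrt (2 * \<mu> * c + c\<^sup>2) \<le> \<mu> * x - c"
    using x assms(2) by (simp add: field_simps)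
  then have "2 * \<mu> * c + c\<^sup>2 \<le> (\<mu> * x - c)\<^sup>2"
    using real_sqrt_le_iff sqrt_le_D by blast
  then have "\<mu> * (2 * c * (1 + x)) \<le> \<mu> * (\<mu> * x\<^sup>2)"
    by (simp add: power2_eq_square algebra_simps)
  then have "2 * c * (1 + x) \<le> \<mu> * x\<^sup>2"
    using assms(2) by simp
  then have "c \<le> \<mu> * (x\<^sup>2 / (2 * (1 + x)))"
    using assms(3) by (simp add: field_simps)
  moreover have "\<mu> * ln (1 + x) \<le> \<mu> * (x - x\<^sup>2 / (2 * (1 + x)))"
    using assms(2,3) by (intro mult_left_mono ln_add_one_le) auto
  ultimately have "c + \<mu> * ln (1 + x) \<le> \<mu> * x"
    by (simp add: algebra_simps)
  then have "(c + \<mu> * ln (1 + x)) * ((1 + x) / x) \<le> \<mu> * x * ((1 + x) / x)"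
    using assms(3) by (intro mult_right_mono) auto
  then show ?thesis
    using assms(3) by simp
qed

text \<open>Every term is at most \<open>m powr k\<close>. The exponent is real because it will be
  \<open>\<mu> * n\<close>.\<close>

lemma ln_chain_weight_le:
  assumes "finite A" and "1 \<le> m" and k: "\<And>C. pred_on.chain A R C \<Longrightarrow> real (card C) \<le> k"
  shows "ln (chain_weight R m A) \<le> ln (real (card {C. pred_on.maxchain A R C})) + k * ln m"
proof -
  let ?N = "real (card {C. pred_on.maxchain A R C})"
  have "m ^ card C \<le> m powr k" if "pred_on.maxchain A R C" for C
    using k[of C] that assms(2) by (simp add: powr_realpow[symmetric] powr_mono pred_on.maxchain_def)
  then have W: "chain_weight R m A \<le> ?N * m powr k"
    unfolding chain_weight_def by (intro sum_bounded_above) auto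
  have "1 \<le> chain_weight R m A"
    using assms(1,2) by (rule chain_weight_ge_1)
  with W have pos: "0 < ?N * m powr k" and "ln (chain_weight R m A) \<le> ln (?N * m powr k)"
    by auto
  moreover have "0 < ?N"
    using pos by (simp add: zero_less_mult_iff)
  ultimately show ?thesis
    using assms(2) by (simp add: ln_mult)
qed

lemma chain_card_le_max_chain_size:
  assumes "finite (carrier P)" and "pred_on.chain (carrier P) (le P) C"
  shows "card C \<le> max_chain_size P"
proof -
  have "finite {C. pred_on.chain (carrier P) (le P) C}"
    by (rule finite_subset[of _ "Pow (carrier P)"]) (use assms in \<open>auto simp: pred_on.chain_def\<close>)
  then show ?thesis
    unfolding max_chain_size_def using assms(2) by (intro Max_ge) auto
qed

section \<open>Choice of \<open>x\<close> and the asymptotic bound\<close>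

theorem theorem1p11:
  fixes p \<Gamma> \<mu> :: real and P :: "nat \<Rightarrow> 'a gorder"
  assumes "0 < p" and "p \<le> 1"
    and "\<forall>n\<ge>1. partial_order (P n) \<and> finite (carrier (P n))"
    and "\<Gamma> \<ge> 1" and "\<mu> > 0"
    and "\<exists>\<epsilon> :: nat \<Rightarrow> real. \<epsilon> \<in> o(\<lambda>_. 1) \<and>
           (\<forall>n\<ge>1. real (card (max_chains (P n))) \<le> \<Gamma> powr ((1 + \<epsilon> n) * real n))"
    and "\<forall>n\<ge>1. real (max_chain_size (P n)) \<le> \<mu> * real n"
  shows "\<exists>r :: nat \<Rightarrow> real. r \<in> o(\<lambda>n. real n) \<and>
           (\<forall>n\<ge>1. expected_steps p (ideal_lattice (P n)) \<le>
              ennreal (1 / p * (\<mu> + ln \<Gamma> + sqrt (2 * \<mu> * ln \<Gamma> + (ln \<Gamma>)\<^sup>2)) * real n + r n))"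
proof -
  from assms(6) obtain \<epsilon> :: "nat \<Rightarrow> real" where \<epsilon>: "\<epsilon> \<in> o(\<lambda>_. 1)"
    and count: "\<And>n. n \<ge> 1 \<Longrightarrow> real (card (max_chains (P n))) \<le> \<Gamma> powr ((1 + \<epsilon> n) * real n)"
    by blast
  define c where "c = ln \<Gamma>"
  have c: "0 \<le> c"
    using assms(4) by (simp add: c_def)
  \<comment> \<open>The root in \<open>chernoff_rate\<close>; at \<open>x = y\<close> its bound
    \<open>\<mu> * (1 + x)\<close> is the constant of the theorem.\<close>
  define y where "y = (c + sqrt (2 * \<mu> * c + c\<^sup>2)) / \<mu>"
  have y: "\<mu> + c + sqrt (2 * \<mu> * c + c\<^sup>2) = \<mu> * (1 + y)"
    using assms(5) by (simp add: y_def field_simps)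
  \<comment> \<open>Stated for all positive \<open>x \<ge> y\<close>, since \<open>y\<close> is 0
    when \<open>c\<close> is 0 and cannot be inserted then.\<close>
  have bound: "expected_steps p (ideal_lattice (P n)) \<le>
      ennreal (1 / p * (\<mu> * (1 + x)) * real n + c * (1 + x) / (p * x) * (\<epsilon> n * real n))"
    if n: "n \<ge> 1" and x: "0 < x" "y \<le> x" for n x
  proof -
    interpret partial_order "P n"
      using assms(3) n by blast
    have fin: "finite (carrier (P n))"
      using assms(3) n by blast
    let ?W = "chain_weight (le (P n)) (1 + x) (carrier (P n))"
    let ?N = "real (card (max_chains (P n)))"
    have "real (card C) \<le> \<mu> * real n" if "pred_on.chain (carrier (P n)) (le (P n)) C" for C
      using chain_card_le_max_chain_size[OF fin that] assms(7) n by fastforce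
    then have W: "ln ?W \<le> ln ?N + \<mu> * real n * ln (1 + x)"
      unfolding max_chains_def using x by (intro ln_chain_weight_le fin) auto
    obtain D where "pred_on.maxchain (carrier (P n)) (le (P n)) D"
      using chain_extends_to_maxchain[OF fin pred_on.chain_empty] .
    then have "?N > 0"
      using finite_maxchains[OF fin] by (auto simp: max_chains_def card_gt_0_iff)
    then have "ln ?N \<le> ln (\<Gamma> powr ((1 + \<epsilon> n) * real n))"
      using count[OF n] by (intro ln_mono) auto
    also have "\<dots> = (1 + \<epsilon> n) * real n * c"
      using assms(4) by (simp add: c_def)
    finally have "ln ?W / (p * x / (1 + x)) \<le>
        ((1 + \<epsilon> n) * real n * c + \<mu> * real n * ln (1 + x)) / (p * x / (1 + x))"
      using W x assms(1) by (intro divide_right_mono) auto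
    also have "\<dots> = 1 / p * ((c + \<mu> * ln (1 + x)) * (1 + x) / x) * real n +
        c * (1 + x) / (p * x) * (\<epsilon> n * real n)"
      using x assms(1) by (simp add: field_simps)
    also have "\<dots> \<le> 1 / p * (\<mu> * (1 + x)) * real n + c * (1 + x) / (p * x) * (\<epsilon> n * real n)"
      using chernoff_rate[OF c assms(5) x(1)] x(2) assms(1)
      by (intro add_right_mono mult_right_mono mult_left_mono) (auto simp: y_def)
    finally show ?thesis
      using expected_steps_ideal_lattice_le[OF fin assms(1,2) x(1)] ennreal_leI order_trans by blast
  qed
  show ?thesis
  proof (cases "c = 0")
    case True
    have "expected_steps p (ideal_lattice (P n)) \<le> ennreal (1 / p * \<mu> * real n)" if n: "n \<ge> 1" for n
    proof (rule ennreal_le_epsilon)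
      fix e :: real assume e: "0 < e"
      \<comment> \<open>Chosen so that the excess \<open>\<mu> * x * n / p\<close> over the claimed
        bound is exactly \<open>e\<close>.\<close>
      define x where "x = e * p / (\<mu> * real n)"
      have "0 < x"
        using e assms(1,5) n by (simp add: x_def)
      from bound[OF n this] True
      have "expected_steps p (ideal_lattice (P n)) \<le> ennreal (1 / p * (\<mu> * (1 + x)) * real n)"
        using \<open>0 < x\<close> by (simp add: y_def)
      also have "1 / p * (\<mu> * (1 + x)) * real n = 1 / p * \<mu> * real n + e"
        using assms(1,5) n by (simp add: x_def field_simps)
      also have "ennreal \<dots> = ennreal (1 / p * \<mu> * real n) + ennreal e"
        using assms(1,5) e by (intro ennreal_plus) auto
      finally show "expected_steps p (ideal_lattice (P n)) \<le> ennreal (1 / p * \<mu> * real n) + ennreal e" .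
    qed
    then show ?thesis
      using True by (intro exI[of _ "\<lambda>_. 0"]) (simp add: c_def)
  next
    case False
    then have "0 < y"
      using c assms(5) by (auto simp: y_def intro!: divide_pos_pos add_pos_nonneg)
    \<comment> \<open>As \<open>x = y\<close> does not depend on \<open>n\<close>, the factor of the
      error term is a constant, and \<open>\<epsilon> n * n\<close> is o(n).\<close>
    define k where "k = c * (1 + y) / (p * y)"
    define r where "r n = k * (\<epsilon> n * real n)" for n
    have "(\<lambda>n. \<epsilon> n * real n) \<in> o(\<lambda>n. 1 * real n)"
      using \<epsilon> by (rule landau_o.small_big_mult) simp
    then have "r \<in> o(\<lambda>n. real n)"
      unfolding r_def by (cases "k = 0") simp_all
    moreover have "expected_steps p (ideal_lattice (P n)) \<le>
        ennreal (1 / p * (\<mu> + c + sqrt (2 * \<mu> * c + c\<^sup>2)) * real n + r n)" if "n \<ge> 1" for n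
      unfolding y r_def k_def using bound[OF that \<open>0 < y\<close>] by simp
    ultimately show ?thesis
      unfolding c_def by blast
  qed
qed

end
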